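(* Let $A$ be an $n \times m$ unimodular matrix with $\operatorname{rank} A = n$. Let $\mathcal{P}_{A}$ be the family of all integer polyhedra $P \subseteq \mathbb{R}^{n}$ such that for every face $F$ of $P$, the subspace $\operatorname{span}(F)$ is generated by some column vectors of $A$ (for a vertex $F$, $\operatorname{span}(F)=\{0\}$ is generated by the empty set of columns). Let $\mathcal{C}_{A} = \{ P \cap \mathbb{Z}^{n} \mid P \in \mathcal{P}_{A} \}$. Then: (DCP1) each $P \in \mathcal{P}_{A}$ is an integer polyhedron; (DCP2) for any $P_{1}, P_{2} \in \mathcal{P}_{A}$, we have $P_{1}+P_{2} \in \mathcal{P}_{A}$ and $(P_{1}+P_{2}) \cap \mathbb{Z}^{n} = (P_{1} \cap \mathbb{Z}^{n}) + (P_{2} \cap \mathbb{Z}^{n})$; (DC1) for any $S \in \mathcal{C}_{A}$, the convex hull $\overline{S}$ is an integer polyhedron and $S = \overline{S} \cap \mathbb{Z}^{n}$; (DC2) for any $S_{1}, S_{2} \in \mathcal{C}_{A}$, we have $S_{1}+S_{2} \in \mathcal{C}_{A}$.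
   Context: An $n\times m$ integer matrix $A$ is unimodular if $\operatorname{rank}A=n$ and every $n\times n$ minor of $A$ lies in $\{0,+1,-1\}$. A polyhedron is a set $\{x \in \mathbb{R}^n \mid Cx \le b\}$ for a finite system of linear inequalities; it is rational if $C,b$ can be taken rational, and it is an integer polyhedron if $P = \overline{P \cap \mathbb{Z}^{n}}$, where $\overline{S}$ denotes the convex hull of $S$ (equivalently, $P$ is rational and every face of $P$ contains an integer point). For sets $S_1,S_2\subseteq\mathbb{R}^n$, $S_1+S_2=\{x+y \mid x\in S_1, y\in S_2\}$ is the Minkowski sum. For a nonempty set $F \subseteq \mathbb{R}^{n}$, $\operatorname{span}(F) = \{ \lambda (x-y) \mid x,y \in F, \lambda \in \mathbb{R}\}$, i.e., the linear subspace parallel to the affine hull of $F$. "Generated by column vectors of $A$" means equal to the linear span of some subset of the columns of $A$. *)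

theory Defs
  imports "HOL-Analysis.Analysis"
begin

text \<open>The minors of order \<open>n\<close> are indexed by injective maps from row indices to column indices;
  reordering the chosen columns only changes the sign.\<close>

definition unimodular :: "int ^ 'm ^ 'n \<Rightarrow> bool" where
  "unimodular A \<longleftrightarrow>
     rank (map_matrix real_of_int A) = CARD('n) \<and>
     (\<forall>f :: 'n \<Rightarrow> 'm. inj f \<longrightarrow> det (\<chi> i j. A $ i $ f j) \<in> {0, 1, -1})"

definition int_lattice :: "(real ^ 'n) set" where
  "int_lattice = {x. \<forall>i. x $ i \<in> \<int>}"

definition integer_polyhedron :: "(real ^ 'n) set \<Rightarrow> bool" where
  "integer_polyhedron P \<longleftrightarrow> polyhedron P \<and> P = convex hull (P \<inter> int_lattice)"

text \<open>The direction space of a nonempty set; for nonempty convex sets it is the linear subspace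
  parallel to the affine hull.\<close>

definition dir_span :: "(real ^ 'n) set \<Rightarrow> (real ^ 'n) set" where
  "dir_span F = {c *\<^sub>R (x - y) | c x y. x \<in> F \<and> y \<in> F}"

definition generated_by_columns :: "int ^ 'm ^ 'n \<Rightarrow> (real ^ 'n) set \<Rightarrow> bool" where
  "generated_by_columns A V \<longleftrightarrow> (\<exists>C \<subseteq> columns (map_matrix real_of_int A). V = span C)"

text \<open>The library relation \<^const>\<open>face_of\<close> also admits the empty face, which has no direction space
  and is excluded here. The empty polyhedron is a member of the family.\<close>

definition poly_family :: "int ^ 'm ^ 'n \<Rightarrow> (real ^ 'n) set set" where
  "poly_family A =
     {P. integer_polyhedron P \<and>
         (\<forall>F. F face_of P \<and> F \<noteq> {} \<longrightarrow> generated_by_columns A (dir_span F))}"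

definition discrete_family :: "int ^ 'm ^ 'n \<Rightarrow> (real ^ 'n) set set" where
  "discrete_family A = {P \<inter> int_lattice | P. P \<in> poly_family A}"

end

theory Submission
  imports Defs
begin

text \<open>Every face of \<open>P + Q\<close> is a sum of faces of \<open>P\<close> and \<open>Q\<close>, and direction spaces add up, so \<open>P + Q\<close>
  inherits the face condition; it is a polyhedron by Fourier--Motzkin elimination, and it is integral
  because convex hulls commute with Minkowski sums.

  For an integer point \<open>z \<in> P + Q\<close>, the polyhedron \<open>P \<inter> (z - Q)\<close> is nonempty and so has a face \<open>G\<close> that
  is an affine subspace. If \<open>x \<in> G\<close> lies in the relative interior of the face \<open>F\<close> of \<open>P\<close> and \<open>z - x\<close> in
  that of the face \<open>H\<close> of \<open>Q\<close>, then \<open>G\<close> contains the intersection of the affine hulls of \<open>F\<close> and \<open>z - H\<close>.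
  Choose integer points \<open>a \<in> F\<close> and \<open>b \<in> H\<close>. The vector \<open>z - a - b\<close> is integral and lies in the sum of
  the direction spaces of \<open>F\<close> and \<open>H\<close>, both spanned by columns of \<open>A\<close>. By Cramer's rule it is an
  integer combination of these columns, hence splits as \<open>u + w\<close> with integral \<open>u\<close>, \<open>w\<close> parallel to
  \<open>F\<close>, \<open>H\<close>, and \<open>z = (a + u) + (b + w)\<close> is the required decomposition.\<close>

subsection \<open>Minkowski sums of polyhedra\<close>

lemma polyhedron_halfspaces:
  fixes S :: "'a::euclidean_space set"
  assumes "polyhedron S"
  obtains I :: "('a \<times> real) set" where "finite I" "S = {x. \<forall>(a, b)\<in>I. a \<bullet> x \<le> b}"
proof -
  obtain F where F: "finite F" "S = \<Inter>F" "\<forall>h\<in>F. \<exists>p. h = {x. fst p \<bullet> x \<le> snd p}"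
    using assms unfolding polyhedron_def by (metis fst_conv snd_conv)
  obtain f where f: "\<forall>h\<in>F. h = {x. fst (f h) \<bullet> x \<le> snd (f h)}"
    using bchoice[OF F(3)] by blast
  show thesis
  proof
    show "finite (f ` F)" using F(1) by simp
    show "S = {x. \<forall>(a, b)\<in>f ` F. a \<bullet> x \<le> b}"
      unfolding F(2) using f by (auto simp: case_prod_beta)
  qed
qed

lemma polyhedron_of_halfspaces:
  fixes I :: "('a::euclidean_space \<times> real) set"
  assumes "finite I"
  shows "polyhedron {x. \<forall>(a, b)\<in>I. a \<bullet> x \<le> b}"
proof -
  have "{x. \<forall>(a, b)\<in>I. a \<bullet> x \<le> b} = \<Inter>((\<lambda>(a, b). {x. a \<bullet> x \<le> b}) ` I)"
    by auto
  then show ?thesis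
    using assms by (auto simp: polyhedron_halfspace_le)
qed

text \<open>The adjoint moves \<open>f\<close> across the inner product, so each inequality on
  \<open>f x\<close> is again one on \<open>x\<close>.\<close>

lemma polyhedron_linear_vimage:
  fixes f :: "'a::euclidean_space \<Rightarrow> 'b::euclidean_space"
  assumes "linear f" "polyhedron S"
  shows "polyhedron (f -` S)"
proof -
  obtain I where I: "finite I" "S = {x. \<forall>(a, b)\<in>I. a \<bullet> x \<le> b}"
    using assms(2) by (rule polyhedron_halfspaces)
  have "f -` S = {x. \<forall>(a, b)\<in>(\<lambda>(a, b). (adjoint f a, b)) ` I. a \<bullet> x \<le> b}"
    unfolding I(2) by (auto simp: adjoint_works[OF assms(1)] adjoint_clauses[OF assms(1)])
  then show ?thesis
    using polyhedron_of_halfspaces[OF finite_imageI[OF I(1)]] by (simp only:)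
qed

text \<open>Supplies the value of an eliminated variable: the largest lower bound works, or the
  least upper bound if there is no lower one.\<close>

lemma real_separate_finite:
  fixes L U :: "real set"
  assumes "finite L" "finite U" "\<And>l u. l \<in> L \<Longrightarrow> u \<in> U \<Longrightarrow> l \<le> u"
  shows "\<exists>t. (\<forall>l\<in>L. l \<le> t) \<and> (\<forall>u\<in>U. t \<le> u)"
proof (cases "L = {}")
  case True
  then show ?thesis
    using assms(2) by (cases "U = {}") (auto intro!: exI[of _ "Min U"])
next
  case False
  then show ?thesis
    using assms by (intro exI[of _ "Max L"]) auto
qed

text \<open>The left side adds a + \<beta> t \<le> c and b + \<alpha> t \<le> d with the positive
  weights \<alpha> and -\<beta>, so that t cancels. The right side compares the bounds on t that
  these two inequalities impose.\<close>

lemma combine_bounds_iff: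
  fixes \<alpha> \<beta> a b c d :: real
  assumes "\<alpha> > 0" "\<beta> < 0"
  shows "\<alpha> * a - \<beta> * b \<le> \<alpha> * c - \<beta> * d \<longleftrightarrow> (c - a) / \<beta> \<le> (d - b) / \<alpha>"
proof -
  have "(c - a) / \<beta> \<le> (d - b) / \<alpha> \<longleftrightarrow> (d - b) * \<beta> / \<alpha> \<le> c - a"
    using assms(2) by (simp add: neg_divide_le_eq)
  also have "\<dots> \<longleftrightarrow> (d - b) * \<beta> \<le> (c - a) * \<alpha>"
    using assms(1) by (simp add: pos_divide_le_eq)
  also have "\<dots> \<longleftrightarrow> \<alpha> * a - \<beta> * b \<le> \<alpha> * c - \<beta> * d"
    by (simp add: algebra_simps)
  finally show ?thesis by simp
qed

text \<open>Fourier--Motzkin elimination of the parameter \<open>t\<close>: every upper bound on \<open>t\<close> must dominate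
  every lower bound.\<close>

lemma polyhedron_add_line:
  fixes S :: "'a::euclidean_space set"
  assumes "polyhedron S"
  shows "polyhedron {x. \<exists>t. x + t *\<^sub>R v \<in> S}"
proof -
  obtain I where I: "finite I" "S = {x. \<forall>(a, b)\<in>I. a \<bullet> x \<le> b}"
    using assms by (rule polyhedron_halfspaces)
  define Z where "Z = {p \<in> I. fst p \<bullet> v = 0}"
  define U where "U = {p \<in> I. fst p \<bullet> v > 0}"
  define L where "L = {p \<in> I. fst p \<bullet> v < 0}"
  \<comment> \<open>The two weights are positive for p in \<open>U\<close> and q in
    \<open>L\<close>, and they make the combined normal vector orthogonal to
    \<open>v\<close>.\<close>
  define comb where "comb = (\<lambda>(p, q). ((fst p \<bullet> v) *\<^sub>R fst q - (fst q \<bullet> v) *\<^sub>R fst p,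
    (fst p \<bullet> v) * snd q - (fst q \<bullet> v) * snd p))"
  define J where "J = Z \<union> comb ` (U \<times> L)"
  have fin: "finite Z" "finite U" "finite L" "finite J"
    using I(1) by (auto simp: Z_def U_def L_def J_def)
  have split: "I = Z \<union> U \<union> L"
    by (auto simp: Z_def U_def L_def)
  have mem: "x + t *\<^sub>R v \<in> S \<longleftrightarrow> (\<forall>p\<in>Z. fst p \<bullet> x \<le> snd p) \<and>
      (\<forall>p\<in>U. t \<le> (snd p - fst p \<bullet> x) / (fst p \<bullet> v)) \<and>
      (\<forall>p\<in>L. (snd p - fst p \<bullet> x) / (fst p \<bullet> v) \<le> t)" for x t
  proof -
    have "x + t *\<^sub>R v \<in> S \<longleftrightarrow> (\<forall>p\<in>I. fst p \<bullet> x + t * (fst p \<bullet> v) \<le> snd p)"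
      unfolding I(2) by (simp add: case_prod_beta inner_right_distrib)
    also have "\<dots> \<longleftrightarrow> (\<forall>p\<in>Z. fst p \<bullet> x + t * (fst p \<bullet> v) \<le> snd p) \<and>
        (\<forall>p\<in>U. fst p \<bullet> x + t * (fst p \<bullet> v) \<le> snd p) \<and>
        (\<forall>p\<in>L. fst p \<bullet> x + t * (fst p \<bullet> v) \<le> snd p)"
      unfolding split by (simp add: ball_Un conj_assoc)
    also have "\<dots> \<longleftrightarrow> (\<forall>p\<in>Z. fst p \<bullet> x \<le> snd p) \<and>
      (\<forall>p\<in>U. t \<le> (snd p - fst p \<bullet> x) / (fst p \<bullet> v)) \<and>
      (\<forall>p\<in>L. (snd p - fst p \<bullet> x) / (fst p \<bullet> v) \<le> t)"
      by (intro arg_cong2[where f="(\<and>)"] ball_cong refl)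
        (auto simp: Z_def U_def L_def pos_le_divide_eq neg_divide_le_eq algebra_simps)
    finally show ?thesis .
  qed
  have comb: "fst (comb (p, q)) \<bullet> x \<le> snd (comb (p, q)) \<longleftrightarrow>
      (snd q - fst q \<bullet> x) / (fst q \<bullet> v) \<le> (snd p - fst p \<bullet> x) / (fst p \<bullet> v)"
    if "p \<in> U" "q \<in> L" for p q x
    using that combine_bounds_iff[of "fst p \<bullet> v" "fst q \<bullet> v" "fst q \<bullet> x" "fst p \<bullet> x" "snd q" "snd p"]
    by (simp add: U_def L_def comb_def inner_diff_left)
  have "(\<exists>t. x + t *\<^sub>R v \<in> S) \<longleftrightarrow> (\<forall>p\<in>J. fst p \<bullet> x \<le> snd p)" for x
  proof
    assume "\<exists>t. x + t *\<^sub>R v \<in> S"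
    then obtain t where t: "x + t *\<^sub>R v \<in> S" ..
    show "\<forall>p\<in>J. fst p \<bullet> x \<le> snd p"
    proof
      fix r assume "r \<in> J"
      then consider "r \<in> Z" | p q where "p \<in> U" "q \<in> L" "r = comb (p, q)"
        unfolding J_def by auto
      then show "fst r \<bullet> x \<le> snd r"
      proof cases
        case 1
        then show ?thesis using t mem by blast
      next
        case (2 p q)
        then show ?thesis using t mem[of x t] comb[of p q x] by fastforce
      qed
    qed
  next
    assume J: "\<forall>p\<in>J. fst p \<bullet> x \<le> snd p"
    let ?g = "\<lambda>p. (snd p - fst p \<bullet> x) / (fst p \<bullet> v)"
    have "?g q \<le> ?g p" if "p \<in> U" "q \<in> L" for p q
      using comb[OF that, of x] J that unfolding J_def by blast
    then have "\<exists>t. (\<forall>l\<in>?g ` L. l \<le> t) \<and> (\<forall>u\<in>?g ` U. t \<le> u)"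
      using fin by (intro real_separate_finite) auto
    then obtain t where "\<forall>l\<in>?g ` L. l \<le> t" "\<forall>u\<in>?g ` U. t \<le> u" by blast
    moreover have "\<forall>p\<in>Z. fst p \<bullet> x \<le> snd p"
      using J unfolding J_def by blast
    ultimately show "\<exists>t. x + t *\<^sub>R v \<in> S"
      using mem[of x t] by blast
  qed
  then show ?thesis
    using polyhedron_of_halfspaces[OF fin(4)] by (simp add: case_prod_beta)
qed

text \<open>Projection along a subspace: the generators are eliminated one at a time.\<close>

lemma polyhedron_add_span:
  fixes S :: "'a::euclidean_space set"
  assumes "finite B" "polyhedron S"
  shows "polyhedron {x. \<exists>w\<in>span B. x + w \<in> S}"
  using assms
proof (induction B arbitrary: S)
  case empty
  then show ?case by simp
next
  case (insert v B)
  have "{x. \<exists>w\<in>span (insert v B). x + w \<in> S} =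
      {x. \<exists>t. x + t *\<^sub>R v \<in> {x. \<exists>w\<in>span B. x + w \<in> S}}" (is "?L = ?R")
  proof (intro set_eqI iffI)
    fix x assume "x \<in> ?L"
    then obtain w t where "x + w \<in> S" "w - t *\<^sub>R v \<in> span B"
      by (auto simp: span_breakdown_eq)
    then show "x \<in> ?R"
      by (auto intro!: exI[of _ t] bexI[of _ "w - t *\<^sub>R v"])
  next
    fix x assume "x \<in> ?R"
    then obtain t w where "x + t *\<^sub>R v + w \<in> S" "w \<in> span B" by auto
    then show "x \<in> ?L"
      by (auto simp: span_breakdown_eq add.assoc intro!: bexI[of _ "t *\<^sub>R v + w"] exI[of _ t])
  qed
  then show ?case
    using polyhedron_add_line[OF insert.IH[OF insert.prems], of v] by simp
qed

text \<open>A point z lies in \<open>S + T\<close> iff (z, 0) can be moved into the product of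
  \<open>S\<close> and \<open>T\<close> along the antidiagonal of all (w, -w). So the sum is a
  linear preimage of a product polyhedron enlarged by a subspace.\<close>

lemma polyhedron_set_plus:
  fixes S T :: "'a::euclidean_space set"
  assumes "polyhedron S" "polyhedron T"
  shows "polyhedron (S + T)"
proof -
  let ?d = "\<lambda>w::'a. (w, - w)"
  let ?P = "fst -` S \<inter> snd -` T"
  have lin: "linear ?d" "linear (\<lambda>z::'a. (z, 0::'a))"
    by (auto simp: linear_iff)
  have "polyhedron ?P"
    using assms by (intro polyhedron_Int polyhedron_linear_vimage linear_fst linear_snd)
  then have "polyhedron {q. \<exists>w\<in>span (?d ` Basis). q + w \<in> ?P}"
    by (intro polyhedron_add_span) auto
  then have "polyhedron ((\<lambda>z. (z, 0)) -` {q. \<exists>w\<in>span (?d ` Basis). q + w \<in> ?P})"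
    using lin(2) by (intro polyhedron_linear_vimage)
  also have "(\<lambda>z. (z, 0)) -` {q. \<exists>w\<in>span (?d ` Basis). q + w \<in> ?P} = S + T"
  proof -
    have "span (?d ` Basis) = range ?d"
      using linear_span_image[OF lin(1), of Basis] by simp
    moreover have "(\<exists>w. z + w \<in> S \<and> - w \<in> T) \<longleftrightarrow> z \<in> S + T" for z
    proof
      assume "\<exists>w. z + w \<in> S \<and> - w \<in> T"
      then obtain w where "z + w \<in> S" "- w \<in> T" by blast
      then show "z \<in> S + T"
        using set_plus_intro[of "z + w" S "- w" T] by simp
    next
      assume "z \<in> S + T"
      then obtain a b where "a \<in> S" "b \<in> T" "z = a + b"
        by (rule set_plus_elim)
      then show "\<exists>w. z + w \<in> S \<and> - w \<in> T"
        by (intro exI[of _ "- b"]) simp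
    qed
    ultimately show ?thesis by auto
  qed
  finally show ?thesis .
qed

subsection \<open>Faces\<close>

text \<open>A point outside the relative interior lies in a proper face, which has smaller
  dimension, and a face of a face is a face.\<close>

lemma polyhedron_face_rel_interior:
  fixes S :: "'a::euclidean_space set"
  assumes "polyhedron S" "x \<in> S"
  shows "\<exists>F. F face_of S \<and> x \<in> rel_interior F"
  using assms
\<comment> \<open>The shift by one keeps the measure faithful at the empty set, whose affine
  dimension is -1.\<close>
proof (induction "nat (aff_dim S + 1)" arbitrary: S rule: less_induct)
  case less
  have cvx: "convex S" using less.prems by (simp add: polyhedron_imp_convex)
  show ?case
  proof (cases "x \<in> rel_interior S")
    case True
    then show ?thesis using cvx face_of_refl by blast
  next
    case False
    then have "x \<in> rel_frontier S"
      using less.prems closure_subset by (auto simp: rel_frontier_def)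
    then obtain F where F: "F face_of S" "F \<noteq> S" "x \<in> F"
      using rel_frontier_of_polyhedron_alt[OF less.prems(1)] by auto
    have "aff_dim F < aff_dim S"
      using face_of_aff_dim_lt[OF cvx F(1,2)] .
    then have "nat (aff_dim F + 1) < nat (aff_dim S + 1)"
      using aff_dim_geq[of F] by linarith
    then show ?thesis
      using less.hyps[of F] face_of_polyhedron_polyhedron[OF less.prems(1) F(1)] F face_of_trans
      by blast
  qed
qed

text \<open>Descending through proper nonempty faces lowers the dimension; the descent ends at an
  empty relative frontier, which forces the set to be affine.\<close>

lemma polyhedron_affine_face:
  fixes S :: "'a::euclidean_space set"
  assumes "polyhedron S" "S \<noteq> {}"
  shows "\<exists>F. F face_of S \<and> F \<noteq> {} \<and> affine F"
  using assms
proof (induction "nat (aff_dim S + 1)" arbitrary: S rule: less_induct)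
  case less
  have cvx: "convex S" using less.prems by (simp add: polyhedron_imp_convex)
  show ?case
  proof (cases "rel_frontier S = {}")
    case True
    then show ?thesis using cvx face_of_refl less.prems by (metis rel_frontier_eq_empty)
  next
    case False
    then obtain F where F: "F face_of S" "F \<noteq> S" "F \<noteq> {}"
      using rel_frontier_of_polyhedron_alt[OF less.prems(1)] by auto
    have "aff_dim F < aff_dim S"
      using face_of_aff_dim_lt[OF cvx F(1,2)] .
    then have "nat (aff_dim F + 1) < nat (aff_dim S + 1)"
      using aff_dim_geq[of F] by linarith
    then show ?thesis
      using less.hyps[of F] face_of_polyhedron_polyhedron[OF less.prems(1) F(1)] F face_of_trans
      by blast
  qed
qed

text \<open>Caratheodory's theorem places a point of \<open>F\<close> in the hull of a finite subset
  \<open>T\<close>, and a face of that polytope is the hull of some points of \<open>T\<close>.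
  Applied to integer polyhedra, this gives an integer point in every nonempty face.\<close>

lemma face_of_convex_hull_meets:
  fixes S :: "'a::euclidean_space set"
  assumes "F face_of convex hull S" "F \<noteq> {}"
  shows "F \<inter> S \<noteq> {}"
proof -
  obtain x where x: "x \<in> F" using assms by blast
  then have "x \<in> convex hull S" using assms face_of_imp_subset by blast
  then obtain T where T: "finite T" "T \<subseteq> S" "x \<in> convex hull T"
    by (auto simp: convex_hull_finite_step caratheodory[of S])
  have sub: "convex hull T \<subseteq> convex hull S" using T by (simp add: hull_mono)
  have "(F \<inter> convex hull T) face_of (convex hull S \<inter> convex hull T)"
    using assms by (intro face_of_slice) auto
  then have "(F \<inter> convex hull T) face_of (convex hull T)"
    using sub by (simp add: Int_absorb1)
  then obtain T' where "T' \<subseteq> T" "F \<inter> convex hull T = convex hull T'"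
    using T(1) face_of_convex_hull_subset finite_imp_compact by metis
  moreover from this have "T' \<noteq> {}" using x T(3) by auto
  ultimately show ?thesis
    using T(2) hull_subset[of T' convex] by blast
qed

lemma face_of_set_plus:
  fixes S T :: "'a::euclidean_space set"
  assumes "convex S" "convex T" "F face_of (S + T)"
  obtains G H where "G face_of S" "H face_of T" "F = G + H"
proof -
  \<comment> \<open>Stated for arbitrary summands, so that exchanging them also gives the face of
    the second one.\<close>
  have left: "{x \<in> S. \<exists>y\<in>T. x + y \<in> F} face_of S"
    if "convex S" "convex T" "F face_of (S + T)" for S T :: "'a set"
    unfolding face_of_def
  proof (intro conjI ballI impI)
    show "{x \<in> S. \<exists>y\<in>T. x + y \<in> F} \<subseteq> S" by blast
    have cF: "convex F" using that face_of_imp_convex by blast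
    show "convex {x \<in> S. \<exists>y\<in>T. x + y \<in> F}"
    proof (rule convexI)
      fix x x' and u v :: real
      assume x: "x \<in> {x \<in> S. \<exists>y\<in>T. x + y \<in> F}" and x': "x' \<in> {x \<in> S. \<exists>y\<in>T. x + y \<in> F}"
        and uv: "0 \<le> u" "0 \<le> v" "u + v = 1"
      obtain y y' where y: "y \<in> T" "x + y \<in> F" "y' \<in> T" "x' + y' \<in> F" using x x' by blast
      have "u *\<^sub>R (x + y) + v *\<^sub>R (x' + y') \<in> F" using cF y uv convexD by blast
      moreover have "u *\<^sub>R (x + y) + v *\<^sub>R (x' + y') = (u *\<^sub>R x + v *\<^sub>R x') + (u *\<^sub>R y + v *\<^sub>R y')"
        by (simp add: algebra_simps)
      moreover have "u *\<^sub>R y + v *\<^sub>R y' \<in> T" "u *\<^sub>R x + v *\<^sub>R x' \<in> S"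
        using that x x' y uv by (auto intro: convexD)
      ultimately show "u *\<^sub>R x + v *\<^sub>R x' \<in> {x \<in> S. \<exists>y\<in>T. x + y \<in> F}" by auto
    qed
    fix a b x
    assume ab: "a \<in> S" "b \<in> S" and x: "x \<in> {x \<in> S. \<exists>y\<in>T. x + y \<in> F}" and seg: "x \<in> open_segment a b"
    obtain y where y: "y \<in> T" "x + y \<in> F" using x by blast
    \<comment> \<open>Translating by the partner \<open>y\<close> turns a segment in
      \<open>S\<close> into one in \<open>S + T\<close> that passes through a point of
      \<open>F\<close>.\<close>
    have "y + x \<in> open_segment (y + a) (y + b)"
      using seg open_segment_translation_eq by blast
    then have "x + y \<in> open_segment (a + y) (b + y)" by (simp add: add.commute)
    moreover have "a + y \<in> S + T" "b + y \<in> S + T" using ab y by auto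
    ultimately have "a + y \<in> F" "b + y \<in> F"
      using that(3) y(2) unfolding face_of_def by blast+
    then show "a \<in> {x \<in> S. \<exists>y\<in>T. x + y \<in> F}" "b \<in> {x \<in> S. \<exists>y\<in>T. x + y \<in> F}"
      using ab y by auto
  qed
  let ?G = "{x \<in> S. \<exists>y\<in>T. x + y \<in> F}" and ?H = "{y \<in> T. \<exists>x\<in>S. y + x \<in> F}"
  show thesis
  proof
    show "?G face_of S" using left assms by blast
    show "?H face_of T" using left[of T S] assms by (simp add: add.commute)
    show "F = ?G + ?H"
    proof
      show "F \<subseteq> ?G + ?H"
      proof
        fix f assume "f \<in> F"
        then obtain x y where xy: "x \<in> S" "y \<in> T" "f = x + y"
          using assms(3) face_of_imp_subset by (metis set_plus_elim subsetD)
        then show "f \<in> ?G + ?H"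
          using \<open>f \<in> F\<close> by (auto intro!: set_plus_intro simp: add.commute)
      qed
      show "?G + ?H \<subseteq> F"
      proof
        fix f assume "f \<in> ?G + ?H"
        then obtain x y x' y' where
          f: "f = x + y" and m: "x \<in> S" "y' \<in> T" "x + y' \<in> F" "y \<in> T" "x' \<in> S" "y + x' \<in> F"
          by (auto elim!: set_plus_elim)
        have cF: "convex F" using assms face_of_imp_convex by blast
        \<comment> \<open>The points \<open>x + y\<close> and \<open>x' + y'\<close> of \<open>S + T\<close> have the same midpoint as
          \<open>x + y'\<close> and \<open>x' + y\<close>, which lie in \<open>F\<close>.\<close>
        have "midpoint (x + y') (y + x') \<in> F"
          using m cF by (meson closed_segment_subset midpoint_in_closed_segment subsetD)
        also have "midpoint (x + y') (y + x') = midpoint (x + y) (x' + y')"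
          by (simp add: midpoint_def algebra_simps)
        finally have mid: "midpoint (x + y) (x' + y') \<in> F" .
        show "f \<in> F"
        proof (cases "x + y = x' + y'")
          case True
          then show ?thesis using mid f by simp
        next
          case False
          then have "midpoint (x + y) (x' + y') \<in> open_segment (x + y) (x' + y')" by simp
          then show ?thesis
            using assms(3) m mid f unfolding face_of_def by (meson set_plus_intro)
        qed
      qed
    qed
  qed
qed

subsection \<open>Unimodular bases\<close>

lemma det_Ints:
  fixes M :: "real ^ 'n ^ 'n"
  assumes "\<And>i j. M $ i $ j \<in> \<int>"
  shows "det M \<in> \<int>"
  unfolding det_def using assms by (intro Ints_sum Ints_mult Ints_prod) auto

lemma det_map_matrix_of_int:
  fixes M :: "int ^ 'n ^ 'n"
  shows "det (map_matrix real_of_int M) = real_of_int (det M)"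
  by (simp add: det_def)

text \<open>The matrix of a basis of columns has a nonzero minor of \<open>A\<close> as determinant,
  hence 1 or -1. In Cramer's rule the numerators are integers, and dividing by this determinant
  keeps them so.\<close>

lemma unimodular_representation_Ints:
  fixes A :: "int ^ 'm ^ 'n"
  assumes "unimodular A" "B \<subseteq> columns (map_matrix real_of_int A)"
    "independent B" "span B = UNIV" "z \<in> int_lattice"
  shows "representation B z b \<in> \<int>"
proof (cases "b \<in> B")
  case False
  then show ?thesis
    using representation_ne_zero[of B z b] by (cases "representation B z b = 0") auto
next
  case True
  have finB: "finite B" using assms(3) by (rule independent_imp_finite)
  have "card B = CARD('n)"
    using dim_eq_card_independent[OF assms(3)] dim_span[of B] assms(4) by simp
  \<comment> \<open>The basis is indexed by the row type, so that it forms a square matrix;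
    \<open>f\<close> below picks for each basis vector the index of a column of \<open>A\<close>
    equal to it.\<close>
  then obtain g :: "'n \<Rightarrow> real ^ 'n" where g: "bij_betw g UNIV B"
    using finB by (metis finite finite_same_card_bij)
  have "\<exists>k. column k (map_matrix real_of_int A) = g j" for j
  proof -
    have "g j \<in> columns (map_matrix real_of_int A)"
      using assms(2) bij_betwE[OF g] by blast
    then show ?thesis by (auto simp: columns_def)
  qed
  then obtain f where f: "\<And>j. column (f j) (map_matrix real_of_int A) = g j" by metis
  have "inj f"
    using g f by (metis bij_betw_imp_inj_on injI inj_onD UNIV_I)
  define N where "N = (\<chi> i j. A $ i $ f j)"
  define M where "M = map_matrix real_of_int N"
  have col: "column j M = g j" for j
    using f[of j] by (simp add: M_def N_def column_def vec_eq_iff)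
  have "det N \<in> {0, 1, -1}"
    using assms(1) \<open>inj f\<close> unfolding unimodular_def N_def by blast
  moreover have "columns M = B"
    using g col by (auto simp: columns_def bij_betw_def)
  then have "rank M = CARD('n)"
    using assms(3) \<open>card B = _\<close> by (simp add: column_rank_def dim_eq_card_independent)
  then have "det M \<noteq> 0"
    by (simp add: det_eq_0_rank)
  ultimately have detM: "det M \<in> {1, -1}"
    by (auto simp: M_def det_map_matrix_of_int)
  define c where "c = (\<chi> j. representation B z (g j))"
  have "M *v c = (\<Sum>j\<in>UNIV. representation B z (g j) *\<^sub>R g j)"
    by (simp add: matrix_mult_sum col c_def scalar_mult_eq_scaleR)
  also have "\<dots> = (\<Sum>b\<in>B. representation B z b *\<^sub>R b)"
    using sum.reindex_bij_betw[OF g] .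
  also have "\<dots> = z"
    using assms finB by (intro sum_representation_eq) auto
  finally have c: "c = (\<chi> k. det (\<chi> i j. if j = k then z $ i else M $ i $ j) / det M)"
    using cramer[of M c z] \<open>det M \<noteq> 0\<close> by simp
  have "c $ k \<in> \<int>" for k
  proof -
    have "det (\<chi> i j. if j = k then z $ i else M $ i $ j) \<in> \<int>"
      using assms(5) by (intro det_Ints) (auto simp: M_def int_lattice_def)
    then show ?thesis
      using detM c by auto
  qed
  moreover obtain k where "b = g k"
    using True g by (auto simp: bij_betw_def)
  ultimately show ?thesis
    by (metis c_def vec_lambda_beta)
qed

lemma int_lattice_add: "x \<in> int_lattice \<Longrightarrow> y \<in> int_lattice \<Longrightarrow> x + y \<in> int_lattice"
  by (auto simp: int_lattice_def)

lemma int_lattice_diff: "x \<in> int_lattice \<Longrightarrow> y \<in> int_lattice \<Longrightarrow> x - y \<in> int_lattice"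
  by (auto simp: int_lattice_def)

lemma columns_map_matrix_int_lattice:
  "columns (map_matrix real_of_int A) \<subseteq> int_lattice"
  by (auto simp: columns_def column_def int_lattice_def)

lemma unimodular_span_columns:
  fixes A :: "int ^ 'm ^ 'n"
  assumes "unimodular A"
  shows "span (columns (map_matrix real_of_int A)) = UNIV"
proof -
  have "dim (columns (map_matrix real_of_int A)) = DIM(real ^ 'n)"
    using assms by (simp add: unimodular_def column_rank_def)
  then show ?thesis
    by (metis dim_eq_full)
qed

text \<open>A basis of the span of C \<union> D taken from these columns extends to a column basis
  of the whole space. The coordinates of \<open>z\<close> are unchanged by the extension, hence
  integral, and the sum splits into basis vectors in \<open>C\<close> and the remaining ones, which
  lie in \<open>D\<close>.\<close>

lemma unimodular_split_int_lattice:
  fixes A :: "int ^ 'm ^ 'n"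
  assumes "unimodular A"
    "C \<subseteq> columns (map_matrix real_of_int A)" "D \<subseteq> columns (map_matrix real_of_int A)"
    "z \<in> int_lattice" "z \<in> span (C \<union> D)"
  obtains u w where "u \<in> span C" "u \<in> int_lattice" "w \<in> span D" "w \<in> int_lattice" "z = u + w"
proof -
  let ?K = "columns (map_matrix real_of_int A)"
  obtain B0 where B0: "B0 \<subseteq> C \<union> D" "independent B0" "C \<union> D \<subseteq> span B0"
    by (rule maximal_independent_subset)
  have "B0 \<subseteq> ?K" using B0 assms by blast
  then obtain B where B: "B0 \<subseteq> B" "B \<subseteq> ?K" "independent B" "?K \<subseteq> span B"
    using B0(2) by (rule maximal_independent_subset_extend)
  have spanB: "span B = UNIV"
    using B(4) unimodular_span_columns[OF assms(1)] by (metis span_mono span_span top.extremum_uniqueI)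
  have finB: "finite B" "finite B0"
    using B B0 independent_imp_finite by blast+
  have z0: "z \<in> span B0"
    using assms(5) B0(3) by (metis span_mono span_span subsetD)
  let ?r = "representation B0 z"
  have r: "?r = representation B z"
    using representation_extend[OF B(3) z0 B(1)] by simp
  have int: "?r b \<in> \<int>" for b
    unfolding r using unimodular_representation_Ints[OF assms(1) B(2,3) spanB assms(4)] .
  have lat: "(\<Sum>b\<in>X. ?r b *\<^sub>R b) \<in> int_lattice" if "X \<subseteq> ?K" for X
  proof -
    have "b $ i \<in> \<int>" if "b \<in> X" for b i
      using that \<open>X \<subseteq> ?K\<close> columns_map_matrix_int_lattice[of A] by (auto simp: int_lattice_def)
    then show ?thesis
      using int by (auto simp: int_lattice_def intro!: Ints_sum Ints_mult)
  qed
  show thesis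
  proof
    show "(\<Sum>b\<in>B0 \<inter> C. ?r b *\<^sub>R b) \<in> span C"
      by (intro span_sum span_scale span_base) auto
    show "(\<Sum>b\<in>B0 - C. ?r b *\<^sub>R b) \<in> span D"
      using B0(1) by (intro span_sum span_scale span_base) auto
    show "(\<Sum>b\<in>B0 \<inter> C. ?r b *\<^sub>R b) \<in> int_lattice" "(\<Sum>b\<in>B0 - C. ?r b *\<^sub>R b) \<in> int_lattice"
      using \<open>B0 \<subseteq> ?K\<close> by (auto intro!: lat)
    have "z = (\<Sum>b\<in>B0. ?r b *\<^sub>R b)"
      using sum_representation_eq[OF B0(2) z0 finB(2)] by simp
    also have "\<dots> = (\<Sum>b\<in>B0 \<inter> C. ?r b *\<^sub>R b) + (\<Sum>b\<in>B0 - C. ?r b *\<^sub>R b)"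
      using finB by (simp add: sum.Int_Diff)
    finally show "z = (\<Sum>b\<in>B0 \<inter> C. ?r b *\<^sub>R b) + (\<Sum>b\<in>B0 - C. ?r b *\<^sub>R b)" .
  qed
qed

subsection \<open>The family of a unimodular matrix\<close>

text \<open>Adding directions of two sets requires one common scalar. Convexity allows any larger
  scalar, by shortening the difference; a negative scalar is first removed by swapping the two
  points.\<close>

lemma dir_span_scale:
  assumes "convex F" "v \<in> dir_span F"
  obtains c where "c \<ge> 0"
    "\<And>e. e \<ge> c \<Longrightarrow> e > 0 \<Longrightarrow> \<exists>p\<in>F. \<exists>q\<in>F. v = e *\<^sub>R (p - q)"
proof -
  have "\<exists>c\<ge>0. \<exists>p\<in>F. \<exists>q\<in>F. v = c *\<^sub>R (p - q)"
  proof -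
    obtain c p q where pq: "p \<in> F" "q \<in> F" "v = c *\<^sub>R (p - q)"
      using assms(2) unfolding dir_span_def by blast
    show ?thesis
    proof (cases "c \<ge> 0")
      case False
      moreover have "v = (- c) *\<^sub>R (q - p)" using pq by (simp add: algebra_simps)
      ultimately show ?thesis
        using pq(1,2) by (intro exI[of _ "- c"] conjI bexI[of _ q] bexI[of _ p]) auto
    qed (use pq in blast)
  qed
  then obtain c p q where pq: "c \<ge> 0" "p \<in> F" "q \<in> F" "v = c *\<^sub>R (p - q)" by blast
  show thesis
  proof
    show "c \<ge> 0" by fact
    fix e :: real assume e: "e \<ge> c" "e > 0"
    \<comment> \<open>The point at fraction c / e of the way from \<open>q\<close> to
      \<open>p\<close>.\<close>
    have "(1 - c / e) *\<^sub>R q + (c / e) *\<^sub>R p \<in> F"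
      using pq e assms(1) by (intro convexD) auto
    moreover have "v = e *\<^sub>R ((1 - c / e) *\<^sub>R q + (c / e) *\<^sub>R p - q)"
      using e pq by (simp add: algebra_simps)
    ultimately show "\<exists>p\<in>F. \<exists>q\<in>F. v = e *\<^sub>R (p - q)"
      using pq by blast
  qed
qed

lemma dir_span_set_plus:
  assumes "convex F" "convex G"
  shows "dir_span (F + G) = dir_span F + dir_span G"
proof
  show "dir_span (F + G) \<subseteq> dir_span F + dir_span G"
  proof
    fix v assume "v \<in> dir_span (F + G)"
    then obtain c x y x' y' where v: "v = c *\<^sub>R ((x + y) - (x' + y'))"
        and m: "x \<in> F" "y \<in> G" "x' \<in> F" "y' \<in> G"
      unfolding dir_span_def by (auto elim!: set_plus_elim)
    have "v = c *\<^sub>R (x - x') + c *\<^sub>R (y - y')"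
      using v by (simp add: algebra_simps)
    then show "v \<in> dir_span F + dir_span G"
      using m unfolding dir_span_def by (auto intro!: set_plus_intro)
  qed
  show "dir_span F + dir_span G \<subseteq> dir_span (F + G)"
  proof
    fix v assume "v \<in> dir_span F + dir_span G"
    then obtain u w where uw: "v = u + w" "u \<in> dir_span F" "w \<in> dir_span G"
      by (auto elim: set_plus_elim)
    obtain c where c: "c \<ge> 0"
      "\<And>e. e \<ge> c \<Longrightarrow> e > 0 \<Longrightarrow> \<exists>p\<in>F. \<exists>q\<in>F. u = e *\<^sub>R (p - q)"
      using dir_span_scale[OF assms(1) uw(2)] by blast
    obtain d where d: "d \<ge> 0"
      "\<And>e. e \<ge> d \<Longrightarrow> e > 0 \<Longrightarrow> \<exists>p\<in>G. \<exists>q\<in>G. w = e *\<^sub>R (p - q)"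
      using dir_span_scale[OF assms(2) uw(3)] by blast
    \<comment> \<open>A common scale above both thresholds; the summand 1 makes it positive.\<close>
    define e where "e = c + d + 1"
    obtain p q where pq: "p \<in> F" "q \<in> F" "u = e *\<^sub>R (p - q)"
      using c(2)[of e] c(1) d(1) unfolding e_def by auto
    obtain p' q' where pq': "p' \<in> G" "q' \<in> G" "w = e *\<^sub>R (p' - q')"
      using d(2)[of e] c(1) d(1) unfolding e_def by auto
    have "v = e *\<^sub>R ((p + p') - (q + q'))"
      using uw pq pq' by (simp add: algebra_simps)
    then show "v \<in> dir_span (F + G)"
      using pq pq' unfolding dir_span_def by blast
  qed
qed

lemma generated_by_columns_set_plus:
  assumes "generated_by_columns A V" "generated_by_columns A W"
  shows "generated_by_columns A (V + W)"
proof -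
  obtain C D where "C \<subseteq> columns (map_matrix real_of_int A)" "V = span C"
    "D \<subseteq> columns (map_matrix real_of_int A)" "W = span D"
    using assms unfolding generated_by_columns_def by blast
  moreover from this have "V + W = span (C \<union> D)"
    by (auto simp: span_Un set_plus_def)
  ultimately show ?thesis
    unfolding generated_by_columns_def by (meson Un_least)
qed

lemma integer_polyhedron_set_plus:
  assumes "integer_polyhedron P" "integer_polyhedron Q"
  shows "integer_polyhedron (P + Q)"
proof -
  have P: "polyhedron P" "polyhedron Q" "P = convex hull (P \<inter> int_lattice)" "Q = convex hull (Q \<inter> int_lattice)"
    using assms by (auto simp: integer_polyhedron_def)
  have poly: "polyhedron (P + Q)" using P by (intro polyhedron_set_plus)
  have "P + Q = convex hull ((P \<inter> int_lattice) + (Q \<inter> int_lattice))"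
    using P by (metis convex_hull_set_plus)
  also have "\<dots> \<subseteq> convex hull ((P + Q) \<inter> int_lattice)"
    by (intro hull_mono) (auto elim!: set_plus_elim intro: int_lattice_add)
  finally have "P + Q \<subseteq> convex hull ((P + Q) \<inter> int_lattice)" .
  moreover have "convex hull ((P + Q) \<inter> int_lattice) \<subseteq> P + Q"
    using poly by (intro hull_minimal) (auto simp: polyhedron_imp_convex)
  ultimately show ?thesis
    using poly by (auto simp: integer_polyhedron_def)
qed

lemma poly_family_set_plus:
  assumes "P \<in> poly_family A" "Q \<in> poly_family A"
  shows "P + Q \<in> poly_family A"
proof -
  have PQ: "integer_polyhedron P" "integer_polyhedron Q"
    using assms by (auto simp: poly_family_def)
  then have cvx: "convex P" "convex Q"
    by (auto simp: integer_polyhedron_def polyhedron_imp_convex)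
  have "generated_by_columns A (dir_span F)" if F: "F face_of (P + Q)" "F \<noteq> {}" for F
  proof -
    obtain G H where GH: "G face_of P" "H face_of Q" "F = G + H"
      using face_of_set_plus[OF cvx F(1)] .
    then have "G \<noteq> {}" "H \<noteq> {}" using F(2) by auto
    then have "generated_by_columns A (dir_span G)" "generated_by_columns A (dir_span H)"
      using GH assms by (auto simp: poly_family_def)
    then show ?thesis
      using GH by (metis dir_span_set_plus face_of_imp_convex generated_by_columns_set_plus)
  qed
  then show ?thesis
    using integer_polyhedron_set_plus[OF PQ] by (auto simp: poly_family_def)
qed

section \<open>Decomposition of the lattice points of a sum\<close>

lemma dir_span_subset_affine_hull:
  assumes "a \<in> affine hull F" "v \<in> dir_span F"
  shows "a + v \<in> affine hull F"
proof -
  obtain c p q where "p \<in> F" "q \<in> F" "v = c *\<^sub>R (p - q)"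
    using assms(2) unfolding dir_span_def by blast
  then show ?thesis
    using mem_affine_3_minus[OF affine_affine_hull assms(1)] by (metis hull_inc)
qed

lemma affine_mem_of_two_points:
  fixes x y :: "'a::real_vector"
  assumes "affine G" "x \<in> G" "x + t *\<^sub>R (y - x) \<in> G" "t \<noteq> 0"
  shows "y \<in> G"
proof -
  have "(1 - 1 / t) *\<^sub>R x + (1 / t) *\<^sub>R (x + t *\<^sub>R (y - x)) \<in> G"
    using assms by (intro mem_affine) auto
  also have "(1 - 1 / t) *\<^sub>R x + (1 / t) *\<^sub>R (x + t *\<^sub>R (y - x)) = y"
    using assms(4) by (simp add: algebra_simps)
  finally show ?thesis .
qed

text \<open>A point \<open>y\<close> of both affine hulls and its mirror image in \<open>x\<close>, after scaling towards \<open>x\<close>, span a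
  segment of \<open>P \<inter> R\<close> through \<open>x\<close>, which must stay in the face \<open>G\<close>.\<close>

lemma affine_face_of_Int:
  fixes P R :: "'a::euclidean_space set"
  assumes "G face_of (P \<inter> R)" "affine G" "x \<in> G"
    "F \<subseteq> P" "x \<in> rel_interior F" "H \<subseteq> R" "x \<in> rel_interior H"
  shows "affine hull F \<inter> affine hull H \<subseteq> G"
proof
  fix y assume y: "y \<in> affine hull F \<inter> affine hull H"
  obtain d where d: "d > 0" "cball x d \<inter> affine hull F \<subseteq> F" "x \<in> F"
    using assms(5) mem_rel_interior_cball by blast
  obtain e where e: "e > 0" "cball x e \<inter> affine hull H \<subseteq> H" "x \<in> H"
    using assms(7) mem_rel_interior_cball by blast
  show "y \<in> G"
  proof (cases "y = x")
    case False
    \<comment> \<open>The points at parameters \<open>t\<close> and \<open>-t\<close> are at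
      distance \<open>min d e\<close> from \<open>x\<close>, hence within both balls.\<close>
    define t where "t = min d e / norm (y - x)"
    have t: "t > 0" "t * norm (y - x) = min d e"
      using False d e by (auto simp: t_def)
    have mem: "x + s *\<^sub>R (y - x) \<in> P \<inter> R" if "\<bar>s\<bar> = t" for s
    proof -
      have "x + s *\<^sub>R (y - x) \<in> cball x (min d e)"
        using t that by (simp add: dist_norm)
      moreover have "x + s *\<^sub>R (y - x) \<in> affine hull F \<inter> affine hull H"
        using y hull_inc[OF d(3)] hull_inc[OF e(3)] mem_affine_3_minus[OF affine_affine_hull] by blast
      ultimately show ?thesis
        using d e assms(4,6) by auto
    qed
    let ?a = "x + t *\<^sub>R (y - x)" and ?b = "x + (- t) *\<^sub>R (y - x)"
    have "?a - ?b = (2 * t) *\<^sub>R (y - x)" by (simp add: algebra_simps flip: scaleR_add_left)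
    then have "?a \<noteq> ?b" using t False by (metis eq_iff_diff_eq_0 mult_pos_pos order_less_irrefl scaleR_eq_0_iff zero_less_numeral)
    moreover have "midpoint ?a ?b = x"
      by (simp add: midpoint_def flip: scaleR_2)
    ultimately have "x \<in> open_segment ?a ?b"
      by (metis midpoint_in_open_segment)
    moreover have "?a \<in> P \<inter> R" "?b \<in> P \<inter> R"
      using mem[of t] mem[of "- t"] t by auto
    ultimately have "?a \<in> G"
      using assms(1,3) unfolding face_of_def by blast
    then show ?thesis
      using affine_mem_of_two_points assms(2,3) t by (metis less_irrefl)
  qed (use assms in simp)
qed

text \<open>The reflection is a negation followed by a translation, and both operators commute with
  each of these.\<close>

lemma affine_hull_rel_interior_reflect:
  fixes F :: "'a::euclidean_space set"
  shows "affine hull ((\<lambda>y. z - y) ` F) = (\<lambda>y. z - y) ` (affine hull F)"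
    and "rel_interior ((\<lambda>y. z - y) ` F) = (\<lambda>y. z - y) ` rel_interior F"
proof -
  have eq: "(\<lambda>y. z - y) ` X = (+) z ` uminus ` X" for X :: "'a set"
    by (simp add: image_image)
  have lin: "linear (uminus :: 'a \<Rightarrow> 'a)" "inj (uminus :: 'a \<Rightarrow> 'a)"
    by (auto simp: linear_uminus)
  show "affine hull ((\<lambda>y. z - y) ` F) = (\<lambda>y. z - y) ` (affine hull F)"
    unfolding eq using lin by (simp only: affine_hull_translation affine_hull_linear_image linear_linear)
  show "rel_interior ((\<lambda>y. z - y) ` F) = (\<lambda>y. z - y) ` rel_interior F"
    unfolding eq using lin by (simp only: rel_interior_translation rel_interior_injective_linear_image linear_linear)
qed

lemma int_lattice_set_plus:
  fixes A :: "int ^ 'm ^ 'n"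
  assumes "unimodular A" "P \<in> poly_family A" "Q \<in> poly_family A"
  shows "(P + Q) \<inter> int_lattice = (P \<inter> int_lattice) + (Q \<inter> int_lattice)"
proof
  show "(P \<inter> int_lattice) + (Q \<inter> int_lattice) \<subseteq> (P + Q) \<inter> int_lattice"
    by (auto elim!: set_plus_elim intro: int_lattice_add)
  show "(P + Q) \<inter> int_lattice \<subseteq> (P \<inter> int_lattice) + (Q \<inter> int_lattice)"
  proof
    fix z assume "z \<in> (P + Q) \<inter> int_lattice"
    then have zi: "z \<in> int_lattice" and zs: "z \<in> P + Q" by auto
    let ?n = "\<lambda>y. z - y"
    have P: "polyhedron P" "P = convex hull (P \<inter> int_lattice)"
      and Q: "polyhedron Q" "Q = convex hull (Q \<inter> int_lattice)"
      using assms by (auto simp: poly_family_def integer_polyhedron_def)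
    \<comment> \<open>This presents z - Q as the sum of the point \<open>z\<close> and -Q, hence as
      a polyhedron.\<close>
    have "?n ` Q = (+) z ` uminus ` Q" by (simp add: image_image)
    then have "polyhedron (?n ` Q)"
      using polyhedron_set_plus[of "{z}" "uminus ` Q"] polyhedron_negations[OF Q(1)]
      by (simp add: affine_imp_polyhedron translation_eq_singleton_plus)
    moreover obtain p q where "p \<in> P" "q \<in> Q" "z = p + q"
      using zs by (rule set_plus_elim)
    then have "p \<in> P \<inter> ?n ` Q"
      by (auto intro!: image_eqI[of _ _ q])
    ultimately obtain G where G: "G face_of (P \<inter> ?n ` Q)" "G \<noteq> {}" "affine G"
      using polyhedron_affine_face[of "P \<inter> ?n ` Q"] P(1) by blast
    then obtain x where x: "x \<in> G" "x \<in> P" "z - x \<in> Q"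
      using face_of_imp_subset by fastforce
    obtain F where F: "F face_of P" "x \<in> rel_interior F"
      using polyhedron_face_rel_interior P(1) x(2) by blast
    obtain H where H: "H face_of Q" "z - x \<in> rel_interior H"
      using polyhedron_face_rel_interior Q(1) x(3) by blast
    have xF: "x \<in> F" "z - x \<in> H"
      using F H rel_interior_subset by blast+
    obtain a where a: "a \<in> F" "a \<in> int_lattice"
      using face_of_convex_hull_meets[of F "P \<inter> int_lattice"] F P(2) xF(1) by force
    obtain b where b: "b \<in> H" "b \<in> int_lattice"
      using face_of_convex_hull_meets[of H "Q \<inter> int_lattice"] H Q(2) xF(2) by force
    obtain C where C: "C \<subseteq> columns (map_matrix real_of_int A)" "dir_span F = span C"
      using assms(2) F(1) xF(1) unfolding poly_family_def generated_by_columns_def by blast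
    obtain D where D: "D \<subseteq> columns (map_matrix real_of_int A)" "dir_span H = span D"
      using assms(3) H(1) xF(2) unfolding poly_family_def generated_by_columns_def by blast
    have diff: "p - q \<in> dir_span X" if "p \<in> X" "q \<in> X" for p q :: "real ^ 'n" and X
      using that unfolding dir_span_def by (metis (mono_tags, lifting) mem_Collect_eq scaleR_one)
    \<comment> \<open>The first summand is a direction of \<open>F\<close>, the second a direction
      of \<open>H\<close>.\<close>
    have "z - a - b = (x - a) + (z - x - b)" by simp
    then have "z - a - b \<in> span (C \<union> D)"
      unfolding span_Un using diff[OF xF(1) a(1)] diff[OF xF(2) b(1)] C(2) D(2) by blast
    moreover have "z - a - b \<in> int_lattice"
      using zi a b by (simp add: int_lattice_diff)
    ultimately obtain u w where uw: "u \<in> span C" "u \<in> int_lattice" "w \<in> span D" "w \<in> int_lattice"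
        "z - a - b = u + w"
      using unimodular_split_int_lattice[OF assms(1) C(1) D(1)] by blast
    have zau: "z - (a + u) = b + w" using uw(5) by (simp add: algebra_simps)
    \<comment> \<open>The integral shifts may leave \<open>F\<close> and \<open>H\<close>
      themselves; only the affine hulls are preserved. Membership in \<open>P\<close> and
      \<open>Q\<close> is recovered through \<open>G\<close>.\<close>
    have "a + u \<in> affine hull F" "b + w \<in> affine hull H"
      using dir_span_subset_affine_hull[OF hull_inc[OF a(1)]]
        dir_span_subset_affine_hull[OF hull_inc[OF b(1)]] uw(1,3) C(2) D(2) by blast+
    moreover have "affine hull F \<inter> affine hull (?n ` H) \<subseteq> G"
    proof (rule affine_face_of_Int[OF G(1,3) x(1)])
      show "F \<subseteq> P" "?n ` H \<subseteq> ?n ` Q"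
        using F H face_of_imp_subset by blast+
      show "x \<in> rel_interior (?n ` H)"
        unfolding affine_hull_rel_interior_reflect using H(2) by (auto intro!: image_eqI[of _ _ "z - x"])
    qed (fact F)
    ultimately have "a + u \<in> G"
      using zau unfolding affine_hull_rel_interior_reflect by (auto intro!: image_eqI[of _ _ "b + w"] simp: algebra_simps)
    then have "a + u \<in> P" "z - (a + u) \<in> Q"
      using G(1) face_of_imp_subset by fastforce+
    then have "a + u \<in> P \<inter> int_lattice" "b + w \<in> Q \<inter> int_lattice"
      using a b uw zau by (auto intro: int_lattice_add)
    moreover have "z = (a + u) + (b + w)" using zau by (simp add: algebra_simps)
    ultimately show "z \<in> (P \<inter> int_lattice) + (Q \<inter> int_lattice)"
      by blast
  qed
qed

theorem theorem3p1:
  fixes A :: "int ^ 'm ^ 'n"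
  assumes "unimodular A"
  shows "(\<forall>P \<in> poly_family A. integer_polyhedron P) \<and>
    (\<forall>P1 \<in> poly_family A. \<forall>P2 \<in> poly_family A.
       P1 + P2 \<in> poly_family A \<and>
       (P1 + P2) \<inter> int_lattice = (P1 \<inter> int_lattice) + (P2 \<inter> int_lattice)) \<and>
    (\<forall>S \<in> discrete_family A.
       integer_polyhedron (convex hull S) \<and> S = convex hull S \<inter> int_lattice) \<and>
    (\<forall>S1 \<in> discrete_family A. \<forall>S2 \<in> discrete_family A. S1 + S2 \<in> discrete_family A)"
proof (intro conjI ballI)
  fix P assume "P \<in> poly_family A"
  then show "integer_polyhedron P" by (simp add: poly_family_def)
next
  fix P1 P2 assume "P1 \<in> poly_family A" "P2 \<in> poly_family A"
  then show "P1 + P2 \<in> poly_family A"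
    and "(P1 + P2) \<inter> int_lattice = (P1 \<inter> int_lattice) + (P2 \<inter> int_lattice)"
    using poly_family_set_plus int_lattice_set_plus assms by blast+
next
  fix S assume "S \<in> discrete_family A"
  then obtain P where P: "integer_polyhedron P" "S = P \<inter> int_lattice"
    by (auto simp: discrete_family_def poly_family_def)
  \<comment> \<open>Integrality of \<open>P\<close> means that its lattice points determine
    it.\<close>
  then have "convex hull S = P" by (simp add: integer_polyhedron_def)
  then show "integer_polyhedron (convex hull S)" "S = convex hull S \<inter> int_lattice"
    using P by auto
next
  fix S1 S2 assume "S1 \<in> discrete_family A" "S2 \<in> discrete_family A"
  then obtain P1 P2 where "P1 \<in> poly_family A" "S1 = P1 \<inter> int_lattice"
    "P2 \<in> poly_family A" "S2 = P2 \<inter> int_lattice"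
    by (auto simp: discrete_family_def)
  moreover from this have "S1 + S2 = (P1 + P2) \<inter> int_lattice"
    using int_lattice_set_plus[OF assms] by simp
  ultimately show "S1 + S2 \<in> discrete_family A"
    using poly_family_set_plus unfolding discrete_family_def by blast
qed

end
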